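(* Let $m\ge1$ be an integer and let $c=\ln\left[\sqrt{m^2\prod_{j=1}^{m-1}\frac1{\sin^2(\pi j/m)}}\right]$. Let $\Omega\subset\mathbb R^2$ be a simply connected domain containing no point $(n\pi,0)$, $n\in\mathbb Z$. (a) For $(x,y)\in\Omega$, $$f^{\mathbb I^3}_{\mathcal S_{\mathrm{tower}}}(x,y)=c+\sum_{j=0}^{m-1}f^{\mathbb I^3}_{\mathcal S_{\mathrm{tower}}}\!\left(\frac{x+j\pi}m,\frac ym\right).$$ (b) For $(x,y)\in\Omega$, with suitable choices of branches, $$f^{\mathbb I^3}_{\mathcal S_{\mathrm{surf}}}(x,y)=\sum_{j=0}^{m-1}f^{\mathbb I^3}_{\mathcal S_{\mathrm{surf}}}\!\left(\frac{x+j\pi}m,\frac ym\right).$$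
   Context: The isotropic Scherk tower and the isotropic Scherk (doubly periodic) surface are the isotropic minimal surfaces that are graphs of $f^{\mathbb I^3}_{\mathcal S_{\mathrm{tower}}}(x,y)=\operatorname{Re}(\ln\sin(x+iy))$ and $f^{\mathbb I^3}_{\mathcal S_{\mathrm{surf}}}(x,y)=\operatorname{Im}(\ln\sin(x+iy))$. In (b), each term is the imaginary part of a holomorphic branch on $\Omega$ of $\ln\sin z$, respectively of $\ln\sin\frac{z+j\pi}m$, where $z=x+iy$. *)

theory Defs
  imports "HOL-Complex_Analysis.Complex_Analysis"
begin

(* The real part of the logarithm does not depend on the branch, so the principal
   branch Ln is used; the value is only meaningful where sin (x + iy) is nonzero. *)
definition scherk_tower :: "real \<Rightarrow> real \<Rightarrow> real" where
  "scherk_tower x y = Re (Ln (sin (Complex x y)))"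

definition plane_to_complex :: "real \<times> real \<Rightarrow> complex" where
  "plane_to_complex p = Complex (fst p) (snd p)"

(* Im (ln (sin z)) is multivalued. This says that f is one of the single-valued branches
   over \<Omega> of Im (ln (sin (w z))), z = x + iy, i.e. the imaginary part of a holomorphic
   logarithm L of sin (w z). With w z = z this is the Scherk surface itself;
   with w z = (z + j pi) / m it is its value at ((x + j pi) / m, y / m). *)
definition scherk_surf_branch ::
  "(real \<times> real) set \<Rightarrow> (complex \<Rightarrow> complex) \<Rightarrow> (real \<Rightarrow> real \<Rightarrow> real) \<Rightarrow> bool" where
  "scherk_surf_branch \<Omega> w f \<longleftrightarrow>
     (\<exists>L. L holomorphic_on (plane_to_complex ` \<Omega>) \<and>
          (\<forall>z \<in> plane_to_complex ` \<Omega>. exp (L z) = sin (w z)) \<and>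
          (\<forall>(x, y) \<in> \<Omega>. f x y = Im (L (Complex x y))))"

end

theory Submission
  imports Defs "HOL-Real_Asymp.Real_Asymp"
begin

text \<open>
  Both parts come from the multiplication formula for the sine, which is obtained by factoring
  \<open>w ^ m - 1\<close> over the roots of unity at \<open>w = exp (-2 \<i> z / m)\<close>. Dividing the formula by
  \<open>sin (z / m)\<close> and letting \<open>z\<close> tend to \<open>0\<close> evaluates the product in the definition of \<open>c\<close> and
  gives \<open>c = (m - 1) ln 2\<close>; part (a) is then the logarithm of the modulus. For (b), holomorphic
  logarithms of the factors exist on the simply connected domain, and their sum plus \<open>c\<close> is a
  logarithm of \<open>sin z\<close>; as \<open>c\<close> is real, it disappears in the imaginary part.
\<close>

text \<open>Two monic polynomials of degree \<open>m\<close> that agree at \<open>m\<close> distinct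
  points are equal; the points here are the \<open>m\<close>-th roots of unity, where both sides
  vanish.\<close>

lemma power_minus_one_eq_prod_roots_unity:
  fixes w :: complex
  assumes "m > 0"
  shows "w ^ m - 1 = (\<Prod>k<m. w - cis (2 * pi * real k / real m))"
proof -
  define p :: "complex poly" where "p = monom 1 m - 1"
  define q :: "complex poly" where "q = (\<Prod>k<m. [:- cis (2 * pi * real k / real m), 1:])"
  have deg_q: "degree q = m"
    by (simp add: q_def degree_prod_sum_eq)
  have "lead_coeff q = 1"
    by (simp add: q_def lead_coeff_prod)
  moreover have "degree p \<le> m"
    unfolding p_def by (intro degree_diff_le degree_monom_le) simp
  moreover have "coeff p m = 1"
    using assms by (simp add: p_def coeff_1)
  moreover have "poly p z = poly q z" if "z \<in> {z. z ^ m = 1}" for z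
  proof -
    obtain k where "k < m" "z = cis (2 * pi * real k / real m)"
      using \<open>z \<in> _\<close> Complex.bij_betw_roots_unity[OF assms] by (force simp: bij_betw_def)
    then have "poly q z = 0"
      unfolding q_def poly_prod by (intro prod_zero) auto
    with that show ?thesis
      by (simp add: p_def poly_monom)
  qed
  ultimately have "p = q"
    using deg_q card_roots_unity_eq[OF assms]
    by (intro poly_eqI_degree_lead_coeff[where n = m and A = "{z. z ^ m = 1}"]) auto
  then have "poly p w = poly q w"
    by simp
  then show ?thesis
    by (simp add: p_def q_def poly_prod poly_monom)
qed

text \<open>The angles add up to \<open>n * pi / 2\<close>. These square roots of the roots of unity
  are the phases left over when a sine is extracted from each linear factor in the multiplication
  formula.\<close>

lemma prod_cis_half_roots_unity:
  "(\<Prod>k<Suc n. cis (pi * real k / real (Suc n))) = \<i> ^ n"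
proof -
  have sum: "(\<Sum>k<Suc n. real k) = real n * real (Suc n) / 2"
    by (induction n) (auto simp: field_simps)
  \<comment> \<open>The number \<open>N\<close> of factors is freed from the denominator
    \<open>Suc n\<close>, which has to stay fixed in the induction.\<close>
  have "(\<Prod>k<N. cis (pi * real k / real (Suc n)))
      = cis (pi / real (Suc n) * (\<Sum>k<N. real k))" for N
    by (induction N) (simp_all add: cis_mult algebra_simps add_divide_distrib)
  from this[of "Suc n"] have "(\<Prod>k<Suc n. cis (pi * real k / real (Suc n))) = cis (real n * (pi / 2))"
    unfolding sum by (simp add: divide_simps mult_ac del: prod.lessThan_Suc)
  also have "\<dots> = \<i> ^ n"
    by (simp only: Complex.DeMoivre [symmetric] cis_pi_half)
  finally show ?thesis .
qed

theorem sin_multiplication_formula: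
  fixes z :: complex
  assumes "m > 0"
  shows "sin z = 2 ^ (m - 1) * (\<Prod>j<m. sin ((z + of_nat j * of_real pi) / of_nat m))"
proof -
  obtain n where m: "m = Suc n"
    using assms by (cases m) auto
  define s where "s j = sin ((z + of_nat j * of_real pi) / of_nat m)" for j :: nat
  \<comment> \<open>Half the exponent of the evaluation point: a factor becomes
    \<open>w\<^sup>2 - e\<^sup>2\<close> with \<open>e = cis (pi * j / m)\<close>, and taking out
    \<open>w * e\<close> leaves \<open>w / e - e / w\<close>, which is -2i times a shifted
    sine.\<close>
  define w where "w = exp (- \<i> * z / of_nat m)"
  have w_power: "w ^ m = exp (- \<i> * z)"
    using assms by (simp add: w_def exp_of_nat_mult [symmetric])
  have factor: "w\<^sup>2 - cis (2 * pi * real j / real m)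
      = (- 2 * \<i>) * w * cis (pi * real j / real m) * s j" for j
  proof -
    define e where "e = cis (pi * real j / real m)"
    have "w \<noteq> 0" "e \<noteq> 0"
      by (simp_all add: w_def e_def)
    have "exp (\<i> * ((z + of_nat j * of_real pi) / of_nat m)) = e / w"
      by (simp add: e_def w_def cis_conv_exp exp_diff [symmetric] algebra_simps add_divide_distrib)
    then have "s j = (e / w - w / e) / (2 * \<i>)"
      by (simp add: s_def sin_exp_eq exp_minus)
    moreover have "cis (2 * pi * real j / real m) = e\<^sup>2"
      by (simp add: e_def power2_eq_square cis_mult mult.assoc)
    ultimately show ?thesis
      unfolding e_def [symmetric] using \<open>w \<noteq> 0\<close> \<open>e \<noteq> 0\<close>
      by (simp add: field_simps power2_eq_square)
  qed
  \<comment> \<open>Since \<open>w ^ m\<close> is exp(-iz), taking it out of the right-hand side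
    leaves exp(-iz) - exp(iz).\<close>
  have "w ^ m * ((- 2 * \<i>) * sin z) = (w\<^sup>2) ^ m - 1"
    unfolding power_mult [symmetric] mult.commute[of 2 m] power_mult[of w m 2] w_power
    by (simp add: sin_exp_eq field_simps power2_eq_square exp_minus)
  also have "\<dots> = (\<Prod>j<m. (- 2 * \<i>) * w * cis (pi * real j / real m) * s j)"
    unfolding power_minus_one_eq_prod_roots_unity[OF assms] by (simp add: factor)
  also have "\<dots> = (- 2 * \<i>) ^ m * w ^ m * \<i> ^ n * prod s {..<m}"
    using prod_cis_half_roots_unity[of n]
    by (simp only: prod.distrib prod_constant card_lessThan power_mult_distrib m)
  \<comment> \<open>One of the \<open>m = Suc n\<close> factors -2i cancels against the left-hand
    side; each of the other \<open>n\<close> meets a factor i and gives 2.\<close>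
  also have "\<dots> = w ^ m * ((- 2 * \<i>) * (((- 2 * \<i>) * \<i>) ^ n * prod s {..<m}))"
    by (simp only: m power_Suc power_mult_distrib mult_ac)
  also have "(- 2 * \<i>) * \<i> = 2"
    by (simp add: mult.assoc)
  finally show ?thesis
    by (simp add: w_def s_def m)
qed

lemma prod_sin_pi_multiples:
  assumes "m > 0"
  shows "2 ^ (m - 1) * (\<Prod>j=1..m-1. sin (pi * real j / real m)) = real m"
proof -
  \<comment> \<open>The multiplication formula at \<open>m * u\<close> without its factor
    \<open>j = 0\<close>, which is \<open>sin u\<close>. So \<open>g\<close> continues
    \<open>sin (m * u) / sin u\<close> to 0, where its value is the product sought.\<close>
  define g where "g u = 2 ^ (m - 1) * (\<Prod>j=1..m-1. sin (u + pi * real j / real m))" for u :: real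
  have "sin (real m * u) = sin u * g u" for u
  proof -
    have "complex_of_real (sin (real m * u))
        = complex_of_real (2 ^ (m - 1) * (\<Prod>j<m. sin (u + pi * real j / real m)))"
      using sin_multiplication_formula[OF assms, of "of_real (real m * u)"] assms
      by (simp add: sin_of_real [symmetric] add_divide_distrib mult_ac)
    then have "sin (real m * u) = 2 ^ (m - 1) * (\<Prod>j<m. sin (u + pi * real j / real m))"
      by (simp only: of_real_eq_iff)
    moreover have "{..<m} = insert 0 {1..m-1}"
      using assms by auto
    ultimately show ?thesis
      by (simp add: g_def)
  qed
  \<comment> \<open>Within distance \<open>pi\<close> of 0 the sine vanishes only at 0
    itself.\<close>
  moreover have "eventually (\<lambda>u::real. sin u \<noteq> 0) (at 0)"
    unfolding eventually_at by (rule exI[of _ pi]) (auto simp: dist_real_def abs_less_iff dest!: sin_eq_0_pi[rotated 2])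
  ultimately have "eventually (\<lambda>u. sin (real m * u) / sin u = g u) (at 0)"
    by (auto elim!: eventually_mono)
  moreover have "((\<lambda>u. sin (real m * u) / sin u) \<longlongrightarrow> real m) (at 0)"
    using assms by real_asymp
  ultimately have "(g \<longlongrightarrow> real m) (at 0)"
    by (rule Lim_transform_eventually[rotated])
  moreover have "(g \<longlongrightarrow> g 0) (at 0)"
    unfolding g_def by (intro tendsto_intros)
  ultimately have "g 0 = real m"
    using tendsto_unique[OF at_neq_bot] by blast
  then show ?thesis
    by (simp add: g_def)
qed

lemma ln_sqrt_prod_inverse_sin:
  assumes "m > 0"
  shows "ln (sqrt ((real m)\<^sup>2 * (\<Prod>j=1..m-1. 1 / (sin (pi * real j / real m))\<^sup>2)))
      = ln (2 ^ (m - 1))"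
proof -
  define P where "P = (\<Prod>j=1..m-1. sin (pi * real j / real m))"
  have eq: "2 ^ (m - 1) * P = real m"
    using prod_sin_pi_multiples[OF assms] by (simp add: P_def)
  then have "P \<noteq> 0"
    using assms by auto
  have "(real m)\<^sup>2 * (\<Prod>j=1..m-1. 1 / (sin (pi * real j / real m))\<^sup>2) = (real m / P)\<^sup>2"
    by (simp add: P_def prod_dividef prod_power_distrib power_divide)
  \<comment> \<open>This quotient is positive, so the square root of its square is the quotient
    itself.\<close>
  also have "real m / P = 2 ^ (m - 1)"
    using eq \<open>P \<noteq> 0\<close> by (simp add: field_simps)
  finally show ?thesis
    by simp
qed

lemma linear_plane_to_complex: "linear plane_to_complex"
  by (rule linearI) (auto simp: plane_to_complex_def complex_eq_iff)

lemma inj_plane_to_complex: "inj plane_to_complex"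
  by (auto simp: inj_def plane_to_complex_def prod_eq_iff)

lemma open_plane_to_complex_image:
  assumes "open S"
  shows "open (plane_to_complex ` S)"
proof (rule open_surjective_linear_image[OF assms linear_plane_to_complex])
  show "surj plane_to_complex"
    by (rule surjI[of _ "\<lambda>z. (Re z, Im z)"]) (simp add: plane_to_complex_def)
qed

text \<open>An injective linear map between finite-dimensional spaces is a homeomorphism onto its
  image. This carries the hypothesis on the real domain over to the complex plane, where holomorphic
  logarithms are available.\<close>

lemma simply_connected_plane_to_complex_image:
  assumes "simply_connected S"
  shows "simply_connected (plane_to_complex ` S)"
  using assms linear_homeomorphic_image[OF linear_plane_to_complex inj_plane_to_complex, of S]
  by (simp add: homeomorphic_simply_connected_eq)

theorem theorem5p2:
  fixes m :: nat and c :: real and \<Omega> :: "(real \<times> real) set"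
  assumes "m \<ge> 1"
    and "c = ln (sqrt ((real m)\<^sup>2 * (\<Prod>j = 1..m - 1. 1 / (sin (pi * real j / real m))\<^sup>2)))"
    and "open \<Omega>" and "connected \<Omega>" and "\<Omega> \<noteq> {}" and "simply_connected \<Omega>"
    and "\<And>n :: int. (of_int n * pi, 0) \<notin> \<Omega>"
  shows "(\<forall>(x, y) \<in> \<Omega>. scherk_tower x y =
            c + (\<Sum>j<m. scherk_tower ((x + real j * pi) / real m) (y / real m))) \<and>
         (\<exists>F G. scherk_surf_branch \<Omega> (\<lambda>z. z) F \<and>
            (\<forall>j<m. scherk_surf_branch \<Omega> (\<lambda>z. (z + of_nat j * of_real pi) / of_nat m) (G j)) \<and>
            (\<forall>(x, y) \<in> \<Omega>. F x y = (\<Sum>j<m. G j x y)))"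
proof -
  define D where "D = plane_to_complex ` \<Omega>"
  define s where "s j z = sin ((z + of_nat j * of_real pi) / of_nat m)" for j :: nat and z :: complex
  have "m > 0"
    using assms(1) by simp
  have c: "c = ln (2 ^ (m - 1))"
    using assms(2) ln_sqrt_prod_inverse_sin[OF \<open>m > 0\<close>] by simp
  have sin_eq: "sin z = 2 ^ (m - 1) * (\<Prod>j<m. s j z)" for z
    unfolding s_def by (rule sin_multiplication_formula[OF \<open>m > 0\<close>])
  have sin_nz: "sin z \<noteq> 0" if "z \<in> D" for z
  proof
    assume "sin z = 0"
    then obtain n :: int where "z = of_real (of_int n * pi)"
      by (auto simp: sin_eq_0)
    with that have "(of_int n * pi, 0) \<in> \<Omega>"
      by (auto simp: D_def plane_to_complex_def complex_eq_iff)
    with assms(7) show False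
      by blast
  qed
  \<comment> \<open>Each \<open>s j z\<close> divides \<open>sin z\<close>, so the zeros of the
    factors need no separate analysis.\<close>
  have s_nz: "s j z \<noteq> 0" if "z \<in> D" "j < m" for j z
    using sin_nz[OF that(1)] that(2) by (auto simp: sin_eq)
  have mem_D: "Complex x y \<in> D" if "(x, y) \<in> \<Omega>" for x y
    using that by (force simp: D_def plane_to_complex_def)
  have tower: "scherk_tower x y = c + (\<Sum>j<m. scherk_tower ((x + real j * pi) / real m) (y / real m))"
    if "(x, y) \<in> \<Omega>" for x y
  proof -
    define z where "z = Complex x y"
    have "z \<in> D"
      using mem_D[OF that] by (simp add: z_def)
    \<comment> \<open>The real part of a logarithm of a nonzero number is the real logarithm of its
      modulus, so (a) becomes an identity between moduli.\<close>
    have "scherk_tower ((x + real j * pi) / real m) (y / real m) = ln (norm (s j z))" if "j < m" for j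
    proof -
      have "Complex ((x + real j * pi) / real m) (y / real m) = (z + of_nat j * of_real pi) / of_nat m"
        by (simp add: z_def complex_eq_iff)
      then show ?thesis
        using s_nz[OF \<open>z \<in> D\<close> that] by (simp add: scherk_tower_def s_def)
    qed
    moreover have "scherk_tower x y = ln (norm (sin z))"
      using sin_nz[OF \<open>z \<in> D\<close>] by (simp add: scherk_tower_def z_def)
    moreover have "ln (norm (sin z)) = c + (\<Sum>j<m. ln (norm (s j z)))"
    proof -
      have "norm (sin z) = 2 ^ (m - 1) * (\<Prod>j<m. norm (s j z))"
        by (simp add: sin_eq norm_mult norm_power prod_norm)
      moreover have "(\<Prod>j<m. norm (s j z)) > 0"
        using s_nz[OF \<open>z \<in> D\<close>] by (intro prod_pos) auto
      moreover have "ln (\<Prod>j<m. norm (s j z)) = (\<Sum>j<m. ln (norm (s j z)))"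
        using s_nz[OF \<open>z \<in> D\<close>] by (intro Transcendental.ln_prod) auto
      ultimately show ?thesis
        by (simp add: c ln_mult del: prod_zero_iff)
    qed
    ultimately show ?thesis
      by simp
  qed
  have "\<exists>L. L holomorphic_on D \<and> (\<forall>z\<in>D. exp (L z) = s j z)" if "j < m" for j
  proof -
    have "s j holomorphic_on D"
      unfolding s_def using \<open>m > 0\<close> by (intro holomorphic_intros) auto
    moreover have "simply_connected D" "locally path_connected D"
      using assms(3,6) simply_connected_plane_to_complex_image open_plane_to_complex_image
      by (auto simp: D_def intro: open_imp_locally_path_connected)
    ultimately show ?thesis
      using s_nz that by (metis simply_connected_imp_holomorphic_log)
  qed
  then obtain L where L: "\<And>j. j < m \<Longrightarrow> L j holomorphic_on D"
    "\<And>j z. j < m \<Longrightarrow> z \<in> D \<Longrightarrow> exp (L j z) = s j z"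
    by metis
  \<comment> \<open>The branch for \<open>sin z\<close> is built from those of the factors: one
    chosen independently could differ from this sum by a nonzero multiple of 2 pi i. The summand
    \<open>c\<close> supplies the factor \<open>2 ^ (m - 1)\<close>.\<close>
  define L0 where "L0 z = of_real c + (\<Sum>j<m. L j z)" for z
  have "L0 holomorphic_on D"
    unfolding L0_def using L(1) by (intro holomorphic_intros) auto
  moreover have "exp (L0 z) = sin z" if "z \<in> D" for z
    using L(2) that by (simp add: L0_def c exp_add exp_sum exp_of_real sin_eq)
  ultimately have "scherk_surf_branch \<Omega> (\<lambda>z. z) (\<lambda>x y. Im (L0 (Complex x y)))"
    unfolding scherk_surf_branch_def D_def [symmetric] by auto
  moreover have "scherk_surf_branch \<Omega> (\<lambda>z. (z + of_nat j * of_real pi) / of_nat m)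
      (\<lambda>x y. Im (L j (Complex x y)))" if "j < m" for j
    using L that unfolding scherk_surf_branch_def D_def [symmetric] s_def by auto
  moreover have "Im (L0 z) = (\<Sum>j<m. Im (L j z))" for z
    by (simp add: L0_def)
  ultimately show ?thesis
    using tower
    by (intro conjI exI[of _ "\<lambda>x y. Im (L0 (Complex x y))"]
        exI[of _ "\<lambda>j x y. Im (L j (Complex x y))"]) auto
qed

end
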